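(* Let $k$ and $d$ be two positive integers satisfying $3\leq k+1\leq d$. For every $n\in\mathbb{N}$ such that $\left\lfloor\frac{(d-1)(k+1)}{2}\right\rfloor < n <\left\lfloor\frac{d(k+1)}{2}\right\rfloor$, the Kneser graph $K_{n+1:k}$ satisfies $\mathrm{Det}(K_{n+1:k})=d$.
   Context: For positive integers $N,k$, the Kneser graph $K_{N:k}$ has as vertices the $k$-element subsets of $[N]=\{1,\ldots,N\}$, two vertices being adjacent exactly when they are disjoint as sets. A set $S\subseteq V(G)$ of vertices of a finite graph $G$ is a determining set of $G$ if whenever $g,h\in\mathrm{Aut}(G)$ satisfy $g(s)=h(s)$ for all $s\in S$, then $g(v)=h(v)$ for all $v\in V(G)$. The determining number $\mathrm{Det}(G)$ is the minimum cardinality of a determining set of $G$. *)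

theory Defs
  imports Complex_Main
begin

text \<open>
  A simple graph is a pair of a vertex set and a set of two-element edges \<open>{u, v}\<close>.
\<close>

type_synonym 'a graph = "'a set \<times> 'a set set"

abbreviation verts :: "'a graph \<Rightarrow> 'a set" where
  "verts G \<equiv> fst G"

abbreviation edges :: "'a graph \<Rightarrow> 'a set set" where
  "edges G \<equiv> snd G"

text \<open>
  Automorphisms are represented by total functions whose values outside \<open>verts G\<close> are
  unconstrained; agreement of automorphisms is therefore only ever tested on vertices.
\<close>

definition graph_aut :: "'a graph \<Rightarrow> ('a \<Rightarrow> 'a) set" where
  "graph_aut G = {g. bij_betw g (verts G) (verts G) \<and>
     (\<forall>u\<in>verts G. \<forall>v\<in>verts G. {u, v} \<in> edges G \<longleftrightarrow> {g u, g v} \<in> edges G)}"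

definition determining_set :: "'a graph \<Rightarrow> 'a set \<Rightarrow> bool" where
  "determining_set G S \<longleftrightarrow> S \<subseteq> verts G \<and>
     (\<forall>g\<in>graph_aut G. \<forall>h\<in>graph_aut G.
        (\<forall>s\<in>S. g s = h s) \<longrightarrow> (\<forall>v\<in>verts G. g v = h v))"

text \<open>
  Intended for finite graphs. The minimum is attained, since \<open>verts G\<close> is itself determining.
\<close>

definition det_number :: "'a graph \<Rightarrow> nat" where
  "det_number G = (LEAST m. \<exists>S. determining_set G S \<and> card S = m)"

text \<open>For \<open>k > 0\<close>, disjoint \<open>k\<close>-subsets are distinct, so there are no loops.\<close>

definition kneser_graph :: "nat \<Rightarrow> nat \<Rightarrow> nat set graph" where
  "kneser_graph N k =
     (let V = {A. A \<subseteq> {1..N} \<and> card A = k}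
      in (V, {{A, B} | A B. A \<in> V \<and> B \<in> V \<and> A \<inter> B = {}}))"

end

theory Submission
  imports Defs "HOL-Combinatorics.Transposition"
begin

text \<open>
  Write \<open>N\<close> for the size of the ground set. The proof has two parts: determining sets of the
  Kneser graph are exactly the families of vertices that separate the points of the ground set,
  and the least size of such a separating family can be computed.

  If no member of a family tells two points apart, the
  transposition of these points fixes every member but not every vertex
  (\<open>determining_imp_separating\<close>). Conversely it suffices that every automorphism is induced by a
  permutation of the ground set. Since \<open>k + 1 \<le> d\<close>, the lower bound on \<open>n\<close> makes \<open>N\<close> so
  large, \<open>N \<ge> 3k - 1\<close>, that the number of common neighbours of two vertices, a binomial coefficient
  in the size of their union, reveals the size of their intersection
  (\<open>kneser_aut_card_Int\<close>). A bijection \<open>f\<close> of the \<open>k\<close>-sets that preserves intersection sizes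
  sends the star of a point to the star of a point (\<open>image_of_star\<close>): weight each point by
  the number of image sets \<open>f A\<close>, for \<open>A\<close> in the star of \<open>x\<close>, that contain it. The weight
  of a \<open>k\<close>-set \<open>f D\<close> then only depends on whether \<open>x\<close> lies in \<open>D\<close>, and a weighting under
  which \<open>k\<close>-sets have only two total weights is constant except at a single point.

  That \<open>d\<close> sets are necessary is a count: for a separating family of \<open>m\<close> sets, the traces
  \<open>{A. x \<in> A}\<close> of the points \<open>x\<close> are distinct. At most one is empty and at most \<open>m\<close> are
  singletons, while their sizes add up to \<open>m k\<close>; hence \<open>2 N \<le> m (k + 1) + 2\<close>
  (\<open>separating_family_bound\<close>).

  That \<open>d\<close> sets suffice is shown in the dual picture, where a separating family of \<open>d\<close> sets of size \<open>k\<close> is a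
  hypergraph on \<open>d\<close> vertices with \<open>N\<close> distinct edges and all degrees equal to \<open>k\<close>. The empty
  set, the singletons and sufficiently many pairs give \<open>N\<close> edges of total size at most \<open>d k\<close>, and
  because \<open>N \<ge> 2k\<close> any such hypergraph can be made regular by changing one edge at a time
  (\<open>regular_hypergraph_exists\<close>).
\<close>

section \<open>Subsets of a fixed size\<close>

definition ksets :: "'a set \<Rightarrow> nat \<Rightarrow> 'a set set" where
  "ksets V k = {A. A \<subseteq> V \<and> card A = k}"

definition separates :: "'a set set \<Rightarrow> 'a set \<Rightarrow> bool" where
  "separates F V \<longleftrightarrow> (\<forall>x\<in>V. \<forall>y\<in>V. (\<forall>A\<in>F. x \<in> A \<longleftrightarrow> y \<in> A) \<longrightarrow> x = y)"

lemma finite_ksets: "finite V \<Longrightarrow> finite (ksets V k)"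
  unfolding ksets_def by (rule finite_subset[of _ "Pow V"]) auto

lemma card_ksets: "finite V \<Longrightarrow> card (ksets V k) = card V choose k"
  unfolding ksets_def by (rule n_subsets)

lemma ksets_avoiding_exists:
  assumes "finite V" "X \<subseteq> V" "k + card X \<le> card V"
  obtains T where "T \<subseteq> V - X" "card T = k" "finite T"
proof -
  have "k \<le> card (V - X)"
    using assms by (simp add: card_Diff_subset finite_subset)
  then obtain T where "T \<subseteq> V - X" "card T = k" "finite T"
    using obtain_subset_with_card_n by blast
  then show thesis by (rule that)
qed

lemma card_ksets_containing:
  assumes V: "finite V" and X: "X \<subseteq> V" "card X \<le> k"
  shows "card {A \<in> ksets V k. X \<subseteq> A} = (card V - card X) choose (k - card X)"
proof -
  have fX: "finite X" using V X finite_subset by blast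
  have "bij_betw (\<lambda>A. A - X) {A \<in> ksets V k. X \<subseteq> A} (ksets (V - X) (k - card X))"
  proof (rule bij_betw_byWitness[where f' = "\<lambda>B. B \<union> X"])
    show "(\<lambda>A. A - X) ` {A \<in> ksets V k. X \<subseteq> A} \<subseteq> ksets (V - X) (k - card X)"
      using fX by (auto simp: ksets_def card_Diff_subset)
    show "(\<lambda>B. B \<union> X) ` ksets (V - X) (k - card X) \<subseteq> {A \<in> ksets V k. X \<subseteq> A}"
    proof clarsimp
      fix B assume B: "B \<in> ksets (V - X) (k - card X)"
      then have "B \<inter> X = {}" "finite B"
        using V by (auto simp: ksets_def dest: finite_subset)
      then have "card (B \<union> X) = card B + card X"
        using fX by (simp add: card_Un_disjoint)
      then show "B \<union> X \<in> ksets V k"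
        using B X by (auto simp: ksets_def)
    qed
  qed (auto simp: ksets_def)
  then have "card {A \<in> ksets V k. X \<subseteq> A} = card (ksets (V - X) (k - card X))"
    by (rule bij_betw_same_card)
  then show ?thesis
    using V X fX by (simp add: card_ksets card_Diff_subset)
qed

lemma card_split:
  assumes "finite H"
  shows "card {P \<in> H. Q P} = card {P \<in> H. Q P \<and> R P} + card {P \<in> H. Q P \<and> \<not> R P}"
proof -
  have "{P \<in> H. Q P} = {P \<in> H. Q P \<and> R P} \<union> {P \<in> H. Q P \<and> \<not> R P}" by blast
  also have "card \<dots> = card {P \<in> H. Q P \<and> R P} + card {P \<in> H. Q P \<and> \<not> R P}"
    using assms by (intro card_Un_disjoint) auto
  finally show ?thesis .
qed

text \<open>
  Strictness already starts at \<open>m = k - 1\<close>, where the left-hand side vanishes; this is what makes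
  \<open>N = 3k - 1\<close> large enough later on.
\<close>
lemma binomial_strict_mono_left:
  assumes "0 < k" "k \<le> Suc m" "m < m'"
  shows "m choose k < m' choose k"
proof -
  have step: "m choose k < Suc m choose k"
    using assms by (cases k) (auto simp: zero_less_binomial_iff)
  have "Suc m choose k \<le> m' choose k"
    using assms by (intro binomial_right_mono) auto
  with step show ?thesis by simp
qed

section \<open>Weightings of points with two subset sums\<close>

text \<open>
  Exchanging a point for another one in a \<open>k\<close>-set changes the total weight by the difference of
  their weights. So the difference of the largest and the smallest weight is \<open>q - p\<close>, and no
  weight lies strictly between them. With two points of each extreme weight, pairs among them would
  extend to \<open>k\<close>-sets of three different totals. Hence one of the two extreme weights is attained
  only once, which gives the two alternatives.
\<close>
lemma two_valued_weight_concentrated: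
  fixes m :: "'a \<Rightarrow> nat"
  assumes V: "finite V" and k: "2 \<le> k" "k + 2 \<le> card V" and pq: "p < q"
    and two: "\<And>E. E \<in> ksets V k \<Longrightarrow> sum m E = p \<or> sum m E = q"
    and P: "\<exists>E\<in>ksets V k. sum m E = p" and Q: "\<exists>E\<in>ksets V k. sum m E = q"
  obtains a where "a \<in> V"
    and "(\<forall>E\<in>ksets V k. sum m E = q \<longleftrightarrow> a \<in> E) \<or> (\<forall>E\<in>ksets V k. sum m E = q \<longleftrightarrow> a \<notin> E)"
proof -
  have ne: "V \<noteq> {}" using k by auto
  have "Max (m ` V) \<in> m ` V" using V ne by simp
  then obtain a where aV: "a \<in> V" "m a = Max (m ` V)" by fastforce
  have a: "a \<in> V" "\<And>v. v \<in> V \<Longrightarrow> m v \<le> m a" using V aV by simp_all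
  have "Min (m ` V) \<in> m ` V" using V ne by simp
  then obtain b where bV: "b \<in> V" "m b = Min (m ` V)" by fastforce
  have b: "b \<in> V" "\<And>v. v \<in> V \<Longrightarrow> m b \<le> m v" using V bV by simp_all
  have lt: "m b < m a"
  proof (rule ccontr)
    assume "\<not> m b < m a"
    then have c: "m v = m a" if "v \<in> V" for v
      using a b that by (meson le_antisym le_trans not_less)
    have "sum m E = k * m a" if "E \<in> ksets V k" for E
    proof -
      have "sum m E = (\<Sum>v\<in>E. m a)" using that c by (intro sum.cong) (auto simp: ksets_def)
      then show ?thesis using that by (simp add: ksets_def)
    qed
    with P Q pq show False by auto
  qed
  have ext: "sum m (insert v T) = m v + sum m T \<and> (sum m (insert v T) = p \<or> sum m (insert v T) = q)"
    if "T \<subseteq> V" "v \<in> V" "v \<notin> T" "card T = k - 1" for v T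
  proof -
    have "finite T" using V that finite_subset by blast
    then have "insert v T \<in> ksets V k" using that k by (simp add: ksets_def)
    then show ?thesis using two[of "insert v T"] \<open>finite T\<close> that by simp
  qed
  \<comment> \<open>Compare \<open>a\<close>, \<open>b\<close> and any \<open>c\<close> as the last point added to one common \<open>(k - 1)\<close>-set.\<close>
  have gap: "m a = m b + (q - p) \<and> (m c = m a \<or> m c = m b)" if c: "c \<in> V" for c
  proof -
    have "card {a, b, c} \<le> 3" by (simp add: card_insert_if)
    then have "k - 1 + card {a, b, c} \<le> card V" using k by linarith
    moreover have "{a, b, c} \<subseteq> V" using a(1) b(1) c by simp
    ultimately obtain T where T: "T \<subseteq> V - {a, b, c}" "card T = k - 1"
      using ksets_avoiding_exists[OF V] by metis
    have "sum m (insert v T) = m v + sum m T \<and> (sum m (insert v T) = p \<or> sum m (insert v T) = q)"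
      if "v \<in> {a, b, c}" for v
      using T that a b c by (intro ext) auto
    then have "m a + sum m T = p \<or> m a + sum m T = q" "m b + sum m T = p \<or> m b + sum m T = q"
      "m c + sum m T = p \<or> m c + sum m T = q" by (metis insertI1 insertI2)+
    then show ?thesis using lt pq by linarith
  qed
  have mb: "m v = m b \<or> m v = m a" if "v \<in> V" for v using gap that by blast
  have gp: "m a = m b + (q - p)" using gap a by blast
  have one: "(\<forall>v\<in>V. m v = m a \<longrightarrow> v = a) \<or> (\<forall>v\<in>V. m v = m b \<longrightarrow> v = b)"
  proof (rule ccontr)
    assume "\<not> ?thesis"
    then obtain a' b' where ab: "a' \<in> V" "m a' = m a" "a' \<noteq> a" "b' \<in> V" "m b' = m b" "b' \<noteq> b"
      by auto
    have "card {a, a', b, b'} \<le> 4" by (simp add: card_insert_if)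
    then have "k - 2 + card {a, a', b, b'} \<le> card V" using k by linarith
    moreover have "{a, a', b, b'} \<subseteq> V" using a(1) b(1) ab by simp
    ultimately obtain T where T: "T \<subseteq> V - {a, a', b, b'}" "card T = k - 2" "finite T"
      using ksets_avoiding_exists[OF V] by metis
    have val: "m u + m v + sum m T = p \<or> m u + m v + sum m T = q"
      if uv: "u \<in> {a, a', b, b'}" "v \<in> {a, a', b, b'}" "u \<noteq> v" for u v
    proof -
      have "sum m (insert u (insert v T)) = m u + sum m (insert v T) \<and>
        (sum m (insert u (insert v T)) = p \<or> sum m (insert u (insert v T)) = q)"
      proof (rule ext)
        have v: "v \<in> V" "v \<notin> T" "u \<in> V" "u \<notin> T" using T(1) uv a(1) b(1) ab by blast+
        then show "insert v T \<subseteq> V" "u \<in> V" "u \<notin> insert v T" using T(1) uv(3) by auto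
        show "card (insert v T) = k - 1" using v T k by simp
      qed
      moreover have "sum m (insert v T) = m v + sum m T"
      proof -
        have "v \<notin> T" using T(1) uv(2) by blast
        then show ?thesis using T(3) by simp
      qed
      ultimately show ?thesis by linarith
    qed
    have "a \<noteq> b" using lt by auto
    then have "m a + m a' + sum m T = p \<or> m a + m a' + sum m T = q"
      "m a + m b + sum m T = p \<or> m a + m b + sum m T = q"
      "m b + m b' + sum m T = p \<or> m b + m b' + sum m T = q"
      using val[of a a'] val[of a b] val[of b b'] ab by auto
    then show False using ab lt pq by linarith
  qed
  \<comment> \<open>Both alternatives at once: \<open>e = 1\<close> for a unique heaviest point \<open>u\<close> and \<open>e = -1\<close> for a
    unique lightest one, the other points having weight \<open>c\<close>.\<close>
  have lin: "int (sum m E) = int k * c + int (q - p) * e * of_bool (u \<in> E)"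
    if E: "E \<in> ksets V k" and u: "u \<in> V"
      and mu: "\<And>v. v \<in> V \<Longrightarrow> int (m v) = c + int (q - p) * e * of_bool (v = u)" for E u c e
  proof -
    have fE: "finite E" using E V by (auto simp: ksets_def dest: finite_subset)
    have "int (sum m E) = (\<Sum>v\<in>E. c + int (q - p) * e * of_bool (v = u))"
      unfolding of_nat_sum using E by (intro sum.cong) (auto simp: ksets_def mu)
    also have "\<dots> = int k * c + int (q - p) * e * of_bool (u \<in> E)"
      using E fE by (simp add: sum.distrib ksets_def flip: sum_distrib_left)
    finally show ?thesis .
  qed
  from one show thesis
  proof
    assume *: "\<forall>v\<in>V. m v = m a \<longrightarrow> v = a"
    have "int (m v) = int (m b) + int (q - p) * 1 * of_bool (v = a)" if "v \<in> V" for v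
    proof (cases "v = a")
      case False
      then have "m v = m b" using mb[OF that] *[rule_format, OF that] by blast
      with False show ?thesis by simp
    qed (simp add: gp)
    then have L: "int (sum m E) = int k * int (m b) + int (q - p) * 1 * of_bool (a \<in> E)"
      if "E \<in> ksets V k" for E using lin[OF that a(1)] by blast
    have "\<forall>E\<in>ksets V k. sum m E = q \<longleftrightarrow> a \<in> E"
    proof -
      obtain E0 E1 where "E0 \<in> ksets V k" "sum m E0 = p" "E1 \<in> ksets V k" "sum m E1 = q"
        using P Q by blast
      with L[of E0] L[of E1] pq have base: "int k * int (m b) = int p"
        by (cases "a \<in> E0"; cases "a \<in> E1") auto
      have "sum m E = q \<longleftrightarrow> a \<in> E" if "E \<in> ksets V k" for E
        using L[OF that] base pq by (cases "a \<in> E") (auto simp del: of_nat_sum)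
      then show ?thesis by blast
    qed
    with a show thesis using that by blast
  next
    assume *: "\<forall>v\<in>V. m v = m b \<longrightarrow> v = b"
    have "int (m v) = int (m a) + int (q - p) * (-1) * of_bool (v = b)" if "v \<in> V" for v
    proof (cases "v = b")
      case False
      then have "m v = m a" using mb[OF that] *[rule_format, OF that] by blast
      with False show ?thesis by simp
    qed (simp add: gp)
    then have L: "int (sum m E) = int k * int (m a) + int (q - p) * (-1) * of_bool (b \<in> E)"
      if "E \<in> ksets V k" for E using lin[OF that b(1)] by blast
    have "\<forall>E\<in>ksets V k. sum m E = q \<longleftrightarrow> b \<notin> E"
    proof -
      obtain E0 E1 where "E0 \<in> ksets V k" "sum m E0 = p" "E1 \<in> ksets V k" "sum m E1 = q"
        using P Q by blast
      with L[of E0] L[of E1] pq have base: "int k * int (m a) = int q"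
        by (cases "b \<in> E0"; cases "b \<in> E1") auto
      have "sum m E = q \<longleftrightarrow> b \<notin> E" if "E \<in> ksets V k" for E
        using L[OF that] base pq by (cases "b \<in> E") (auto simp del: of_nat_sum)
      then show ?thesis by blast
    qed
    with b show thesis using that by blast
  qed
qed

section \<open>Bijections preserving intersection sizes\<close>

text \<open>
  Summing \<open>card (A \<inter> D)\<close> over the star of \<open>x\<close> tells whether \<open>x \<in> D\<close>, and \<open>f\<close> does not change
  this sum. Rewritten as a sum of weights over the points of \<open>f D\<close>, it takes two values only, so
  that membership of \<open>x\<close> in \<open>D\<close> is membership or non-membership of a single point \<open>a\<close> in \<open>f D\<close>.
  Non-membership would equate \<open>(N - 1 choose k - 1)\<close> with \<open>(N - 1 choose k)\<close> and force
  \<open>N = 2k\<close>, where complementation is indeed a counterexample.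
\<close>
lemma image_of_star:
  assumes V: "finite V" and k: "2 \<le> k" "2 * k < card V"
    and f: "bij_betw f (ksets V k) (ksets V k)"
    and int: "\<And>A B. \<lbrakk>A \<in> ksets V k; B \<in> ksets V k\<rbrakk> \<Longrightarrow> card (f A \<inter> f B) = card (A \<inter> B)"
    and x: "x \<in> V"
  shows "\<exists>a\<in>V. \<forall>D\<in>ksets V k. a \<in> f D \<longleftrightarrow> x \<in> D"
proof -
  let ?star = "{A \<in> ksets V k. x \<in> A}"
  define \<alpha> where "\<alpha> = (card V - 1) choose (k - 1)"
  define \<beta> where "\<beta> = (card V - 2) choose (k - 2)"
  have fs: "finite ?star" using finite_ksets[OF V] by simp
  have card_star: "card ?star = \<alpha>"
    using card_ksets_containing[OF V, of "{x}" k] x k by (simp add: \<alpha>_def)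
  have card_pair: "card {A \<in> ?star. v \<in> A} = (if v = x then \<alpha> else \<beta>)" if "v \<in> V" for v
  proof (cases "v = x")
    case True
    then have "{A \<in> ?star. v \<in> A} = ?star" by auto
    then show ?thesis using True card_star by simp
  next
    case False
    have "{A \<in> ?star. v \<in> A} = {A \<in> ksets V k. {x, v} \<subseteq> A}" by auto
    then show ?thesis
      using False card_ksets_containing[OF V, of "{x, v}" k] x that k
      by (simp add: \<beta>_def numeral_2_eq_2)
  qed
  have "card V - 1 = Suc (card V - 2)" "k - 1 = Suc (k - 2)" using k by auto
  then have "\<alpha> = ((card V - 2) choose (k - 2)) + ((card V - 2) choose (k - 1))"
    unfolding \<alpha>_def by simp
  moreover have "0 < (card V - 2) choose (k - 1)" using k by (simp add: zero_less_binomial_iff)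
  ultimately have ab: "\<beta> < \<alpha>" by (simp add: \<beta>_def)
  define m where "m v = card {A \<in> ?star. v \<in> f A}" for v
  define p where "p = k * \<beta>"
  define q where "q = p + (\<alpha> - \<beta>)"
  have pq: "p < q" using ab by (simp add: q_def)
  have sum_star: "(\<Sum>A\<in>?star. card (A \<inter> D)) = (if x \<in> D then q else p)" if D: "D \<in> ksets V k" for D
  proof -
    have fD: "finite D" and DV: "D \<subseteq> V" "card D = k"
      using D V by (auto simp: ksets_def dest: finite_subset)
    have "(\<Sum>A\<in>?star. card (A \<inter> D)) = (\<Sum>A\<in>?star. card {v\<in>D. v \<in> A})"
      by (intro sum.cong arg_cong[where f = card]) auto
    also have "\<dots> = (\<Sum>v\<in>D. if v = x then \<alpha> else \<beta>)"
      using card_pair DV by (intro sum_multicount_gen[OF fs fD] ballI) blast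
    also have "\<dots> = (\<Sum>v\<in>D. \<beta> + (if v = x then \<alpha> - \<beta> else 0))"
      using ab by (intro sum.cong) auto
    also have "\<dots> = (if x \<in> D then q else p)"
      using fD DV by (simp add: sum.distrib p_def q_def)
    finally show ?thesis .
  qed
  have sum_m: "sum m (f D) = (if x \<in> D then q else p)" if D: "D \<in> ksets V k" for D
  proof -
    have "f D \<in> ksets V k" using f D bij_betwE by blast
    then have fD: "finite (f D)" using V by (auto simp: ksets_def dest: finite_subset)
    have "sum m (f D) = (\<Sum>A\<in>?star. card {v\<in>f D. v \<in> f A})"
      using fs fD by (intro sum_multicount_gen[symmetric]) (auto simp: m_def)
    also have "\<dots> = (\<Sum>A\<in>?star. card (A \<inter> D))"
    proof (intro sum.cong refl)
      fix A assume "A \<in> ?star"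
      then have "card (f A \<inter> f D) = card (A \<inter> D)" using int D by auto
      moreover have "{v\<in>f D. v \<in> f A} = f A \<inter> f D" by auto
      ultimately show "card {v\<in>f D. v \<in> f A} = card (A \<inter> D)" by simp
    qed
    finally show ?thesis using sum_star[OF D] by simp
  qed
  have surj: "\<exists>D\<in>ksets V k. E = f D" if "E \<in> ksets V k" for E
    using f that by (auto simp: bij_betw_def)
  obtain T where T: "T \<subseteq> V - {x}" "card T = k" "finite T"
    using ksets_avoiding_exists[OF V, of "{x}" k] x k by auto
  obtain U where U: "U \<subseteq> V - {x}" "card U = k - 1" "finite U"
    using ksets_avoiding_exists[OF V, of "{x}" "k - 1"] x k by auto
  have T': "T \<in> ksets V k" "x \<notin> T" using T by (auto simp: ksets_def)
  have U': "insert x U \<in> ksets V k" using U x k by (auto simp: ksets_def card_insert_if)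
  have fin: "f D \<in> ksets V k" if "D \<in> ksets V k" for D using f that bij_betwE by blast
  obtain a where a: "a \<in> V"
    and alt: "(\<forall>E\<in>ksets V k. sum m E = q \<longleftrightarrow> a \<in> E) \<or> (\<forall>E\<in>ksets V k. sum m E = q \<longleftrightarrow> a \<notin> E)"
  proof (rule two_valued_weight_concentrated[of V k p q m])
    show "sum m E = p \<or> sum m E = q" if "E \<in> ksets V k" for E
      using surj[OF that] sum_m by auto
    show "\<exists>E\<in>ksets V k. sum m E = p" using T' fin sum_m by (metis (full_types))
    show "\<exists>E\<in>ksets V k. sum m E = q" using U' fin sum_m by (metis insertI1)
  qed (use V k pq in auto)
  from alt show ?thesis
  proof
    assume "\<forall>E\<in>ksets V k. sum m E = q \<longleftrightarrow> a \<in> E"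
    then have "a \<in> f D \<longleftrightarrow> x \<in> D" if "D \<in> ksets V k" for D
      using that fin sum_m[OF that] pq by (metis less_irrefl)
    with a show ?thesis by blast
  next
    assume "\<forall>E\<in>ksets V k. sum m E = q \<longleftrightarrow> a \<notin> E"
    then have not: "a \<notin> f D \<longleftrightarrow> x \<in> D" if "D \<in> ksets V k" for D
      using that fin sum_m[OF that] pq by (metis less_irrefl)
    have "f ` ?star = {E \<in> ksets V k. a \<notin> E}"
      using not fin surj by blast
    also have "\<dots> = ksets (V - {a}) k" by (auto simp: ksets_def)
    finally have "card (f ` ?star) = (card V - 1) choose k"
      using a V by (simp add: card_ksets)
    moreover have "inj_on f ?star" using f by (auto simp: bij_betw_def inj_on_def)
    ultimately have eq: "\<alpha> = (card V - 1) choose k" using card_star by (simp add: card_image)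
    \<comment> \<open>By Pascal's rule, stars contain half of all \<open>k\<close>-sets; by double counting incidences,
      they contain the fraction \<open>k / card V\<close>.\<close>
    have "card V = Suc (card V - 1)" "k = Suc (k - 1)" using k by auto
    then have "card V choose k = \<alpha> + ((card V - 1) choose k)"
      unfolding \<alpha>_def by (metis binomial_Suc_Suc)
    then have "card V choose k = 2 * \<alpha>" using eq by simp
    moreover have "k * (card V choose k) = card V * \<alpha>"
      unfolding \<alpha>_def using k by (intro times_binomial_minus1_eq) simp
    moreover have "0 < \<alpha>" using ab by simp
    ultimately have "card V = 2 * k" by simp
    with k show ?thesis by simp
  qed
qed

lemma induced_by_permutation:
  assumes V: "finite V" and k: "2 \<le> k" "2 * k < card V"
    and f: "bij_betw f (ksets V k) (ksets V k)"
    and int: "\<And>A B. \<lbrakk>A \<in> ksets V k; B \<in> ksets V k\<rbrakk> \<Longrightarrow> card (f A \<inter> f B) = card (A \<inter> B)"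
  obtains \<sigma> where "bij_betw \<sigma> V V" "\<And>D. D \<in> ksets V k \<Longrightarrow> f D = \<sigma> ` D"
proof -
  have "\<forall>x\<in>V. \<exists>a. a \<in> V \<and> (\<forall>D\<in>ksets V k. a \<in> f D \<longleftrightarrow> x \<in> D)"
    using image_of_star[OF V k f int] by blast
  then obtain \<sigma> where s: "\<And>x. x \<in> V \<Longrightarrow> \<sigma> x \<in> V"
    "\<And>x D. x \<in> V \<Longrightarrow> D \<in> ksets V k \<Longrightarrow> \<sigma> x \<in> f D \<longleftrightarrow> x \<in> D"
    by (metis bchoice)
  have inj: "inj_on \<sigma> V"
  proof (rule inj_onI, rule ccontr)
    fix x y assume xy: "x \<in> V" "y \<in> V" "\<sigma> x = \<sigma> y" "x \<noteq> y"
    obtain U where U: "U \<subseteq> V - {x, y}" "card U = k - 1" "finite U"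
      using ksets_avoiding_exists[OF V, of "{x, y}" "k - 1"] xy k by auto
    then have "insert x U \<in> ksets V k" using xy k by (auto simp: ksets_def card_insert_if)
    moreover have "y \<notin> insert x U" using U xy by auto
    ultimately show False using s(2) xy by (metis insertI1)
  qed
  have bij: "bij_betw \<sigma> V V"
    using inj s(1) V by (simp add: bij_betw_def endo_inj_surj image_subsetI)
  have "f D = \<sigma> ` D" if D: "D \<in> ksets V k" for D
  proof -
    have "f D \<in> ksets V k" using f D bij_betwE by blast
    then have fD: "finite (f D)" "card (f D) = k" using V by (auto simp: ksets_def dest: finite_subset)
    have DV: "D \<subseteq> V" "card D = k" using D by (auto simp: ksets_def)
    have "\<sigma> ` D \<subseteq> f D" using s(2) D DV by auto
    moreover have "card (\<sigma> ` D) = k" using inj DV by (simp add: card_image inj_on_subset)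
    ultimately show ?thesis using fD by (metis card_subset_eq)
  qed
  with bij show thesis by (rule that)
qed

section \<open>Kneser graphs\<close>

lemma verts_kneser: "verts (kneser_graph N k) = ksets {1..N} k"
  by (simp add: kneser_graph_def ksets_def Let_def)

lemma edges_kneser:
  assumes "A \<in> ksets {1..N} k" "B \<in> ksets {1..N} k"
  shows "{A, B} \<in> edges (kneser_graph N k) \<longleftrightarrow> A \<inter> B = {}"
  using assms by (auto simp: kneser_graph_def ksets_def Let_def doubleton_eq_iff)

lemma kneser_aut_iff:
  "g \<in> graph_aut (kneser_graph N k) \<longleftrightarrow>
     bij_betw g (ksets {1..N} k) (ksets {1..N} k) \<and>
     (\<forall>A\<in>ksets {1..N} k. \<forall>B\<in>ksets {1..N} k. A \<inter> B = {} \<longleftrightarrow> g A \<inter> g B = {})"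
proof -
  have "({A, B} \<in> edges (kneser_graph N k) \<longleftrightarrow> {g A, g B} \<in> edges (kneser_graph N k)) \<longleftrightarrow>
      (A \<inter> B = {} \<longleftrightarrow> g A \<inter> g B = {})"
    if "bij_betw g (ksets {1..N} k) (ksets {1..N} k)" "A \<in> ksets {1..N} k" "B \<in> ksets {1..N} k" for A B
    using that edges_kneser bij_betwE[OF that(1)] by simp
  then show ?thesis
    unfolding graph_aut_def verts_kneser mem_Collect_eq by (intro conj_cong refl ball_cong)
qed

text \<open>
  The common neighbours of \<open>A\<close> and \<open>B\<close> are the \<open>k\<close>-subsets of the complement of \<open>A \<union> B\<close>, which
  has \<open>N - 2k + t\<close> points for \<open>t = card (A \<inter> B)\<close>. From \<open>N \<ge> 3k - 1\<close> on, their number is strictly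
  increasing in \<open>t\<close>.
\<close>
lemma kneser_aut_card_Int:
  assumes k: "0 < k" "3 * k \<le> N + 1" and g: "g \<in> graph_aut (kneser_graph N k)"
    and A: "A \<in> ksets {1..N} k" and B: "B \<in> ksets {1..N} k"
  shows "card (g A \<inter> g B) = card (A \<inter> B)"
proof -
  let ?K = "ksets {1..N} k"
  let ?C = "\<lambda>A B. {D \<in> ?K. A \<inter> D = {} \<and> B \<inter> D = {}}"
  have bij: "bij_betw g ?K ?K" and adj: "\<And>A B. A \<in> ?K \<Longrightarrow> B \<in> ?K \<Longrightarrow> A \<inter> B = {} \<longleftrightarrow> g A \<inter> g B = {}"
    using g by (auto simp: kneser_aut_iff)
  have gA: "g A \<in> ?K" and gB: "g B \<in> ?K" using bij A B bij_betwE by blast+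
  have count: "card (?C X Y) = (N - 2 * k + card (X \<inter> Y)) choose k"
    if "X \<in> ?K" "Y \<in> ?K" for X Y
  proof -
    have XY: "X \<subseteq> {1..N}" "Y \<subseteq> {1..N}" "card X = k" "card Y = k" using that by (auto simp: ksets_def)
    have f: "finite X" "finite Y" using XY(1,2) finite_subset by blast+
    have "?C X Y = ksets ({1..N} - (X \<union> Y)) k" by (auto simp: ksets_def)
    moreover have "card ({1..N} - (X \<union> Y)) = N - card (X \<union> Y)"
      using XY(1,2) f by (subst card_Diff_subset) auto
    ultimately have "card (?C X Y) = (N - card (X \<union> Y)) choose k"
      by (simp only: card_ksets finite_Diff finite_atLeastAtMost)
    moreover have "card (X \<union> Y) + card (X \<inter> Y) = 2 * k"
      using card_Un_Int[OF f] XY by simp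
    moreover have "N - card (X \<union> Y) = N - 2 * k + card (X \<inter> Y)"
      using calculation(2) k by linarith
    ultimately show ?thesis by simp
  qed
  have "g ` ?C A B = ?C (g A) (g B)"
  proof (intro equalityI subsetI)
    fix E assume "E \<in> g ` ?C A B"
    then obtain D where D: "D \<in> ?K" "A \<inter> D = {}" "B \<inter> D = {}" "E = g D" by blast
    then have "g D \<in> ?K" using bij bij_betwE by blast
    then show "E \<in> ?C (g A) (g B)" using D adj[OF A D(1)] adj[OF B D(1)] by simp
  next
    fix E assume E: "E \<in> ?C (g A) (g B)"
    then have "E \<in> g ` ?K" using bij_betw_imp_surj_on[OF bij] by blast
    then obtain D where D: "D \<in> ?K" "E = g D" by (elim imageE)
    then have "D \<in> ?C A B" using E adj[OF A D(1)] adj[OF B D(1)] by simp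
    then show "E \<in> g ` ?C A B" using D(2) by blast
  qed
  moreover have "inj_on g (?C A B)" using bij by (auto simp: bij_betw_def inj_on_def)
  ultimately have eq: "card (?C A B) = card (?C (g A) (g B))" using card_image[of g "?C A B"] by simp
  have no_less: "\<not> s < t" if "(N - 2 * k + s) choose k = (N - 2 * k + t) choose k" for s t
  proof
    assume "s < t"
    moreover have "k \<le> Suc (N - 2 * k + s)" using k by linarith
    ultimately show False
      using binomial_strict_mono_left[OF k(1), of "N - 2 * k + s" "N - 2 * k + t"] that by simp
  qed
  have "(N - 2 * k + card (A \<inter> B)) choose k = (N - 2 * k + card (g A \<inter> g B)) choose k"
    using eq count[OF A B] count[OF gA gB] by simp
  then show ?thesis using no_less by (metis nat_neq_iff)
qed

text \<open>
  Automorphisms that agree on \<open>S\<close> are induced by permutations \<open>\<sigma>\<close> and \<open>\<tau>\<close> with equal images on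
  the members of \<open>S\<close>. Then \<open>x\<close> and the \<open>\<tau>\<close>-preimage of \<open>\<sigma> x\<close> lie in the same members of \<open>S\<close>,
  hence coincide.
\<close>
lemma separating_imp_determining:
  assumes k: "2 \<le> k" "3 * k \<le> N + 1"
    and S: "S \<subseteq> ksets {1..N} k" "separates S {1..N}"
  shows "determining_set (kneser_graph N k) S"
  unfolding determining_set_def verts_kneser
proof (intro conjI ballI impI)
  fix g h D
  assume g: "g \<in> graph_aut (kneser_graph N k)" and h: "h \<in> graph_aut (kneser_graph N k)"
    and gh: "\<forall>s\<in>S. g s = h s" and D: "D \<in> ksets {1..N} k"
  have perm: "\<exists>\<sigma>. bij_betw \<sigma> {1..N} {1..N} \<and> (\<forall>D\<in>ksets {1..N} k. f D = \<sigma> ` D)"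
    if f: "f \<in> graph_aut (kneser_graph N k)" for f
  proof -
    have bij: "bij_betw f (ksets {1..N} k) (ksets {1..N} k)" using f by (simp add: kneser_aut_iff)
    obtain \<sigma> where "bij_betw \<sigma> {1..N} {1..N}" "\<And>D. D \<in> ksets {1..N} k \<Longrightarrow> f D = \<sigma> ` D"
    proof -
      have "finite {1..N}" "2 * k < card {1..N}" "0 < k" using k by simp_all
      note * = induced_by_permutation[OF this(1) k(1) this(2) bij kneser_aut_card_Int[OF this(3) k(2) f]]
      show thesis by (rule *) (use that in blast)+
    qed
    then show ?thesis by blast
  qed
  obtain \<sigma> \<tau> where s: "bij_betw \<sigma> {1..N} {1..N}" "\<And>D. D \<in> ksets {1..N} k \<Longrightarrow> g D = \<sigma> ` D"
    and t: "bij_betw \<tau> {1..N} {1..N}" "\<And>D. D \<in> ksets {1..N} k \<Longrightarrow> h D = \<tau> ` D"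
    using perm[OF g] perm[OF h] by (elim exE conjE) simp
  have "\<sigma> x = \<tau> x" if x: "x \<in> {1..N}" for x
  proof -
    have "\<sigma> x \<in> \<tau> ` {1..N}" using bij_betwE[OF s(1)] bij_betw_imp_surj_on[OF t(1)] x by blast
    then obtain y where y: "y \<in> {1..N}" "\<sigma> x = \<tau> y" by blast
    have "x \<in> A \<longleftrightarrow> y \<in> A" if A: "A \<in> S" for A
    proof -
      have AK: "A \<in> ksets {1..N} k" using A S by blast
      then have AN: "A \<subseteq> {1..N}" by (simp add: ksets_def)
      have "\<sigma> ` A = \<tau> ` A" using gh A s(2)[OF AK] t(2)[OF AK] by simp
      moreover have "x \<in> A \<longleftrightarrow> \<sigma> x \<in> \<sigma> ` A"
        using inj_on_image_mem_iff[OF bij_betw_imp_inj_on[OF s(1)] x AN] by simp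
      moreover have "y \<in> A \<longleftrightarrow> \<tau> y \<in> \<tau> ` A"
        using inj_on_image_mem_iff[OF bij_betw_imp_inj_on[OF t(1)] y(1) AN] by simp
      ultimately show ?thesis using y(2) by simp
    qed
    then have "x = y" using S(2)[unfolded separates_def, rule_format, OF x y(1)] by blast
    with y show ?thesis by simp
  qed
  then have "\<sigma> ` D = \<tau> ` D" using D by (intro image_cong) (auto simp: ksets_def)
  then show "g D = h D" using s(2)[OF D] t(2)[OF D] by simp
qed (use S in auto)

text \<open>
  If \<open>x\<close> and \<open>y\<close> lie in the same members of \<open>S\<close>, their transposition agrees with the identity on
  \<open>S\<close> but moves any \<open>k\<close>-set that contains \<open>x\<close> and not \<open>y\<close>.
\<close>
lemma determining_imp_separating:
  assumes k: "0 < k" "k < N" and det: "determining_set (kneser_graph N k) S"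
  shows "separates S {1..N}"
  unfolding separates_def
proof (intro ballI impI, rule ccontr)
  fix x y assume xy: "x \<in> {1..N}" "y \<in> {1..N}" "x \<noteq> y" and tr: "\<forall>A\<in>S. x \<in> A \<longleftrightarrow> y \<in> A"
  define t where "t = transpose x y"
  have tb: "bij t" by (simp add: t_def)
  have tN: "t ` {1..N} = {1..N}" unfolding t_def using xy by (intro transpose_image_eq) auto
  have tt: "t ` t ` A = A" for A by (simp add: t_def image_image)
  have tK: "t ` A \<in> ksets {1..N} k" if "A \<in> ksets {1..N} k" for A
  proof -
    have "inj_on t A" using tb by (auto simp: bij_def inj_on_def)
    then show ?thesis using that tN by (auto simp: ksets_def card_image)
  qed
  have aut: "(\<lambda>A. t ` A) \<in> graph_aut (kneser_graph N k)"
    unfolding kneser_aut_iff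
  proof (intro conjI ballI)
    show "bij_betw (\<lambda>A. t ` A) (ksets {1..N} k) (ksets {1..N} k)"
      by (rule bij_betw_byWitness[where f' = "\<lambda>A. t ` A"]) (use tt tK in auto)
    show "(A \<inter> B = {}) = (t ` A \<inter> t ` B = {})" for A B
      using tb by (simp add: bij_is_inj flip: image_Int)
  qed
  have id: "(\<lambda>A. A) \<in> graph_aut (kneser_graph N k)"
    unfolding kneser_aut_iff using bij_betw_id[of "ksets {1..N} k"] by (simp add: id_def)
  have "t ` A = A" if "A \<in> S" for A
    unfolding t_def using tr that by (intro transpose_image_eq) auto
  then have fix_all: "t ` A = A" if "A \<in> ksets {1..N} k" for A
  proof -
    have agree: "\<forall>v\<in>ksets {1..N} k. g v = h v"
      if "g \<in> graph_aut (kneser_graph N k)" "h \<in> graph_aut (kneser_graph N k)" "\<forall>s\<in>S. g s = h s" for g h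
      using det that unfolding determining_set_def verts_kneser by simp
    show ?thesis using agree[OF aut id] \<open>\<And>A. A \<in> S \<Longrightarrow> t ` A = A\<close> that by simp
  qed
  obtain U where U: "U \<subseteq> {1..N} - {x, y}" "card U = k - 1" "finite U"
    using ksets_avoiding_exists[of "{1..N}" "{x, y}" "k - 1"] xy k by auto
  then have "insert x U \<in> ksets {1..N} k" using xy k by (auto simp: ksets_def card_insert_if)
  then have "t x \<in> insert x U" using fix_all by blast
  then show False using U xy by (auto simp: t_def)
qed

section \<open>Separating families\<close>

text \<open>
  The traces of the points are distinct and, by double counting, have total size
  \<open>card S * k\<close>. All but the empty trace and at most \<open>card S\<close> singletons have size at least \<open>2\<close>.
\<close>
lemma separating_family_bound:
  assumes V: "finite V" and S: "S \<subseteq> ksets V k" "separates S V"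
  shows "2 * card V \<le> card S * (k + 1) + 2"
proof -
  have fS: "finite S" using finite_subset[OF S(1) finite_ksets[OF V]] .
  define tr where "tr x = {A \<in> S. x \<in> A}" for x
  have inj: "inj_on tr V"
    using S(2) by (auto simp: inj_on_def separates_def tr_def)
  have fin: "finite (tr x)" for x using fS by (simp add: tr_def)
  have incid: "(\<Sum>x\<in>V. card (tr x)) = (\<Sum>A\<in>S. k)"
    unfolding tr_def
  proof (rule sum_multicount_gen[OF V fS], rule ballI)
    fix A assume "A \<in> S"
    then have "{x \<in> V. x \<in> A} = A" "card A = k" using S(1) by (auto simp: ksets_def)
    then show "card {x \<in> V. x \<in> A} = k" by simp
  qed
  have zero: "card {x \<in> V. tr x = {}} \<le> 1"
    by (rule card_le_Suc0_iff_eq[THEN iffD2, unfolded One_nat_def[symmetric]])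
       (use V inj in \<open>auto simp: inj_on_def\<close>)
  have one: "card {x \<in> V. card (tr x) = 1} \<le> card S"
  proof -
    have "tr ` {x \<in> V. card (tr x) = 1} \<subseteq> (\<lambda>A. {A}) ` S"
    proof clarify
      fix x assume "card (tr x) = 1"
      then obtain A where "tr x = {A}" using card_1_singletonE by blast
      moreover have "A \<in> S" using \<open>tr x = {A}\<close> by (auto simp: tr_def)
      ultimately show "tr x \<in> (\<lambda>A. {A}) ` S" by blast
    qed
    then have "card (tr ` {x \<in> V. card (tr x) = 1}) \<le> card ((\<lambda>A. {A}) ` S)"
      using fS by (intro card_mono) auto
    also have "\<dots> = card S" by (simp add: card_image)
    finally show ?thesis
      using inj by (simp add: card_image inj_on_subset)
  qed
  have "2 * card V = (\<Sum>x\<in>V. 2)" by simp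
  also have "\<dots> \<le> (\<Sum>x\<in>V. card (tr x) + 2 * of_bool (tr x = {}) + of_bool (card (tr x) = 1))"
  proof (rule sum_mono)
    fix x
    have "card (tr x) = 0 \<longleftrightarrow> tr x = {}" using fin by simp
    then show "2 \<le> card (tr x) + 2 * of_bool (tr x = {}) + of_bool (card (tr x) = 1)"
      by (cases "card (tr x) = 0"; cases "card (tr x) = 1") auto
  qed
  also have "\<dots> = card S * k + 2 * card {x \<in> V. tr x = {}} + card {x \<in> V. card (tr x) = 1}"
    using V incid by (simp add: sum.distrib flip: sum_distrib_left) (simp add: Int_def)
  also have "\<dots> \<le> card S * (k + 1) + 2" using zero one by simp
  finally show ?thesis .
qed

section \<open>Regular hypergraphs\<close>

text \<open>
  The induction decreases the sum over all vertices of the distance between the degree and \<open>k\<close>; the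
  summand is this distance, since one of the two truncated differences is zero.

  Unless \<open>H\<close> is regular, the bound on the total size yields a vertex \<open>j\<close> of degree less than \<open>k\<close>.
  If some vertex \<open>i\<close> has degree more than \<open>k\<close>, more edges contain \<open>i\<close> but not \<open>j\<close> than the other
  way round, so in some edge \<open>i\<close> can be exchanged for \<open>j\<close> without creating an edge that is
  already present. If no degree exceeds \<open>k\<close>, there is room to add \<open>j\<close> to an edge; some edge admits
  this without creating a duplicate, because \<open>j\<close> lies in fewer than half of the at least \<open>2k\<close> edges.
\<close>
lemma regular_hypergraph_exists:
  assumes I: "finite I"
    and H: "H \<subseteq> Pow I" "2 * k \<le> card H" "(\<Sum>P\<in>H. card P) \<le> card I * k"
  shows "\<exists>H'\<subseteq>Pow I. card H' = card H \<and> (\<forall>i\<in>I. card {P \<in> H'. i \<in> P} = k)"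
  using H
proof (induction "\<Sum>i\<in>I. (card {P \<in> H. i \<in> P} - k) + (k - card {P \<in> H. i \<in> P})"
    arbitrary: H rule: less_induct)
  case less
  let ?deg = "\<lambda>H i. card {P \<in> H. i \<in> P}"
  have fH: "finite H" using less.prems(1) I finite_subset by blast
  have fin: "finite P" if "P \<in> H" for P using less.prems(1) I that finite_subset by blast
  have deg_sum: "(\<Sum>P\<in>H. card P) = (\<Sum>i\<in>I. ?deg H i)"
  proof -
    have "(\<Sum>P\<in>H. card P) = (\<Sum>P\<in>H. card {i\<in>I. i \<in> P})"
      using less.prems(1) by (intro sum.cong arg_cong[where f = card]) auto
    also have "\<dots> = (\<Sum>i\<in>I. ?deg H i)" using fH I by (intro sum_multicount_gen) auto
    finally show ?thesis .
  qed
  show ?case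
  proof (cases "\<forall>i\<in>I. ?deg H i = k")
    case True
    then show ?thesis using less.prems by blast
  next
    case False
    have "\<exists>j\<in>I. ?deg H j < k"
    proof (rule ccontr)
      assume "\<not> ?thesis"
      then have ge: "k \<le> ?deg H i" if "i \<in> I" for i using that by (meson not_less)
      from False obtain i where i: "i \<in> I" "?deg H i \<noteq> k" by blast
      then have "k < ?deg H i" using ge[OF i(1)] by simp
      with ge have "(\<Sum>i\<in>I. k) < (\<Sum>i\<in>I. ?deg H i)"
        using I i(1) by (intro sum_strict_mono_ex1) blast+
      then show False using less.prems(3) deg_sum by simp
    qed
    then obtain j where j: "j \<in> I" "?deg H j < k" by blast
    \<comment> \<open>Either way an edge \<open>P\<close> is replaced by a new edge \<open>Q\<close> that gains \<open>j\<close> and loses only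
      vertices of too large degree.\<close>
    have improve: ?thesis
      if P: "P \<in> H" and Q: "Q \<subseteq> I" "Q \<notin> H"
        and total: "(\<Sum>P\<in>H. card P) + card Q \<le> card I * k + card P"
        and jj: "j \<notin> P" "j \<in> Q"
        and up: "\<And>i. i \<in> P - Q \<Longrightarrow> k < ?deg H i"
        and down: "\<And>i. i \<in> Q - P \<Longrightarrow> i = j" for P Q
    proof -
      let ?H = "insert Q (H - {P})"
      have card: "card ?H = card H" using P Q fH card_Suc_Diff1[OF fH P] by simp
      have sub: "?H \<subseteq> Pow I" using Q less.prems(1) by auto
      have "(\<Sum>P\<in>H. card P) = card P + (\<Sum>P\<in>H - {P}. card P)"
        using P fH by (simp add: sum.remove)
      then have tot: "(\<Sum>P\<in>?H. card P) \<le> card I * k" using total Q fH by simp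
      have deg: "?deg ?H i + of_bool (i \<in> P) = ?deg H i + of_bool (i \<in> Q)" for i
      proof -
        let ?R = "{R \<in> H - {P}. i \<in> R}"
        have "{R \<in> ?H. i \<in> R} = (if i \<in> Q then insert Q ?R else ?R)" by auto
        then have 1: "?deg ?H i = card ?R + of_bool (i \<in> Q)" using Q fH by simp
        have "{R \<in> H. i \<in> R} = (if i \<in> P then insert P ?R else ?R)" using P by auto
        then have 2: "?deg H i = card ?R + of_bool (i \<in> P)" using fH by simp
        from 1 2 show ?thesis by simp
      qed
      have le: "(?deg ?H i - k) + (k - ?deg ?H i) \<le> (?deg H i - k) + (k - ?deg H i)" for i
      proof -
        consider "i \<in> P - Q" | "i = j" | "i \<in> P \<longleftrightarrow> i \<in> Q" using down by blast
        then show ?thesis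
        proof cases
          case 1 then show ?thesis using deg[of i] up[of i] by auto
        next
          case 2 then show ?thesis using deg[of i] jj j(2) by auto
        next
          case 3 then show ?thesis using deg[of i] by auto
        qed
      qed
      have lt: "(?deg ?H j - k) + (k - ?deg ?H j) < (?deg H j - k) + (k - ?deg H j)"
        using deg[of j] jj j(2) by auto
      have "(\<Sum>i\<in>I. (?deg ?H i - k) + (k - ?deg ?H i)) < (\<Sum>i\<in>I. (?deg H i - k) + (k - ?deg H i))"
      proof (rule sum_strict_mono_ex1[OF I])
        show "\<exists>i\<in>I. (?deg ?H i - k) + (k - ?deg ?H i) < (?deg H i - k) + (k - ?deg H i)"
          using lt j(1) by (rule bexI[where x = j])
      qed (rule ballI, rule le)
      from less.hyps[OF this sub _ tot] card less.prems(2) show ?thesis by simp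
    qed
    show ?thesis
    proof (cases "\<exists>i\<in>I. k < ?deg H i")
      case True
      then obtain i where i: "i \<in> I" "k < ?deg H i" by blast
      then have ij: "i \<noteq> j" using j by auto
      let ?move = "\<lambda>P. insert j (P - {i})"
      let ?A = "{P \<in> H. i \<in> P \<and> j \<notin> P}" and ?B = "{P \<in> H. j \<in> P \<and> i \<notin> P}"
      have "\<exists>P\<in>?A. ?move P \<notin> H"
      proof (rule ccontr)
        assume "\<not> ?thesis"
        then have "?move ` ?A \<subseteq> ?B" using ij by auto
        moreover have "inj_on ?move ?A"
          by (rule inj_on_inverseI[where g = "\<lambda>P. insert i (P - {j})"]) (use ij in auto)
        ultimately have "card ?A \<le> card ?B" using fH by (intro card_inj_on_le) auto
        moreover have "?deg H i = card {P \<in> H. i \<in> P \<and> j \<in> P} + card ?A"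
          using card_split[OF fH] .
        moreover have "?deg H j = card {P \<in> H. j \<in> P \<and> i \<in> P} + card ?B"
          using card_split[OF fH] .
        moreover have "card {P \<in> H. j \<in> P \<and> i \<in> P} = card {P \<in> H. i \<in> P \<and> j \<in> P}"
          by (simp only: conj_commute)
        ultimately have "?deg H i \<le> ?deg H j" by linarith
        then show False using i j by linarith
      qed
      then obtain P where P: "P \<in> H" "i \<in> P" "j \<notin> P" "?move P \<notin> H" by blast
      show ?thesis
      proof (rule improve[OF P(1) _ P(4)])
        show "?move P \<subseteq> I" using P less.prems(1) j by auto
        have "card (?move P) = card P"
          using P fin[OF P(1)] card_Suc_Diff1[OF fin[OF P(1)] P(2)] by simp
        then show "(\<Sum>P\<in>H. card P) + card (?move P) \<le> card I * k + card P"
          using less.prems(3) by simp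
      qed (use P i ij in auto)
    next
      case False
      then have "(\<Sum>i\<in>I. ?deg H i) < (\<Sum>i\<in>I. k)"
        using I j by (intro sum_strict_mono_ex1) (auto simp: not_less)
      then have room: "(\<Sum>P\<in>H. card P) < card I * k" using deg_sum by simp
      let ?A = "{P \<in> H. j \<notin> P}"
      have "\<exists>P\<in>?A. insert j P \<notin> H"
      proof (rule ccontr)
        assume "\<not> ?thesis"
        then have "insert j ` ?A \<subseteq> {P \<in> H. j \<in> P}" by auto
        moreover have "inj_on (insert j) ?A" by (auto simp: inj_on_def)
        ultimately have "card ?A \<le> ?deg H j" using fH by (intro card_inj_on_le) auto
        moreover have "card H = ?deg H j + card ?A"
          using card_split[OF fH, of "\<lambda>_. True" "\<lambda>P. j \<in> P"] by simp
        ultimately show False using j less.prems(2) by linarith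
      qed
      then obtain P where P: "P \<in> H" "j \<notin> P" "insert j P \<notin> H" by blast
      show ?thesis
      proof (rule improve[OF P(1) _ P(3)])
        show "insert j P \<subseteq> I" using P less.prems(1) j by auto
        show "(\<Sum>P\<in>H. card P) + card (insert j P) \<le> card I * k + card P"
          using room P fin[OF P(1)] by simp
      qed (use P in auto)
    qed
  qed
qed

text \<open>
  The empty set, the singletons and pairs: \<open>N\<close> edges of the smallest possible total size
  \<open>2N - 2 - card I\<close>.
\<close>
lemma light_hypergraph_exists:
  assumes I: "finite I" and N: "card I + 1 \<le> N" "N \<le> card I + 1 + (card I choose 2)"
  obtains H where "H \<subseteq> Pow I" "card H = N" "(\<Sum>P\<in>H. card P) + card I + 2 = 2 * N"
proof -
  have "N - (card I + 1) \<le> card (ksets I 2)" using N by (simp add: card_ksets[OF I])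
  then obtain E where E: "E \<subseteq> ksets I 2" "card E = N - (card I + 1)" "finite E"
    using obtain_subset_with_card_n by blast
  let ?S = "(\<lambda>i. {i}) ` I"
  have fS: "finite ?S" "card ?S = card I" using I by (auto simp: card_image)
  have dis: "?S \<inter> E = {}" "{} \<notin> ?S \<union> E" using E by (auto simp: ksets_def)
  have sS: "(\<Sum>P\<in>?S. card P) = card I"
    by (subst sum.reindex) (auto simp: inj_on_def)
  have "(\<Sum>P\<in>E. card P) = (\<Sum>P\<in>E. 2)" using E by (intro sum.cong) (auto simp: ksets_def)
  then have sE: "(\<Sum>P\<in>E. card P) = 2 * card E" by simp
  show thesis
  proof (rule that[of "insert {} (?S \<union> E)"])
    show "insert {} (?S \<union> E) \<subseteq> Pow I" using E by (auto simp: ksets_def)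
    have "card (?S \<union> E) = card I + card E" using fS E dis by (simp add: card_Un_disjoint)
    then show "card (insert {} (?S \<union> E)) = N" using fS E dis N by simp
    have "(\<Sum>P\<in>?S \<union> E. card P) = card I + 2 * card E"
      using fS E dis sS sE by (simp add: sum.union_disjoint)
    then show "(\<Sum>P\<in>insert {} (?S \<union> E). card P) + card I + 2 = 2 * N"
      using fS E dis N by simp
  qed
qed

text \<open>
  Label the points by the edges of a \<open>k\<close>-regular hypergraph on \<open>d\<close> vertices. Each vertex \<open>i\<close> of
  the hypergraph gives the set of the \<open>k\<close> points whose label contains \<open>i\<close>, and the label of a
  point is its trace in this family of sets.
\<close>
lemma separating_family_exists:
  assumes V: "finite V" and k: "2 * k \<le> card V"
    and d: "d + 1 \<le> card V" "card V \<le> d + 1 + (d choose 2)" "2 * card V \<le> d * (k + 1) + 2"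
  obtains S where "S \<subseteq> ksets V k" "separates S V" "card S \<le> d"
proof -
  let ?I = "{..<d}"
  obtain H where H: "H \<subseteq> Pow ?I" "card H = card V" "(\<Sum>P\<in>H. card P) + d + 2 = 2 * card V"
    using light_hypergraph_exists[of ?I "card V"] d by auto
  then have "(\<Sum>P\<in>H. card P) \<le> card ?I * k" using d(3) by simp
  then obtain H' where H': "H' \<subseteq> Pow ?I" "card H' = card V" "\<forall>i\<in>?I. card {P \<in> H'. i \<in> P} = k"
    using regular_hypergraph_exists[of ?I H k] H k by auto
  have "finite H'" using H'(1) finite_subset by blast
  then obtain b where b: "bij_betw b V H'" using V H'(2) finite_same_card_bij by metis
  define s where "s i = {x \<in> V. i \<in> b x}" for i
  have "card (s i) = k" if i: "i < d" for i
  proof -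
    have "bij_betw b (s i) {P \<in> H'. i \<in> P}"
      using b unfolding s_def bij_betw_def by (auto simp: inj_on_def)
    then show ?thesis using H'(3) i by (simp add: bij_betw_same_card)
  qed
  then have sub: "s ` ?I \<subseteq> ksets V k" by (auto simp: ksets_def s_def)
  have "separates (s ` ?I) V"
    unfolding separates_def
  proof (intro ballI impI)
    fix x y assume xy: "x \<in> V" "y \<in> V" and eq: "\<forall>A\<in>s ` ?I. x \<in> A \<longleftrightarrow> y \<in> A"
    have "b x \<subseteq> ?I" "b y \<subseteq> ?I" using b xy H'(1) by (auto simp: bij_betw_def)
    moreover have "i \<in> b x \<longleftrightarrow> i \<in> b y" if "i < d" for i
      using eq xy that by (auto simp: s_def)
    ultimately have "b x = b y" by auto
    then show "x = y" using b xy by (auto simp: bij_betw_def inj_on_def)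
  qed
  moreover have "card (s ` ?I) \<le> d" using card_image_le[of ?I s] by simp
  ultimately show thesis using that sub by blast
qed

section \<open>The determining number\<close>

theorem theorem3p5:
  fixes k d n :: nat
  assumes "0 < k" and "0 < d"
    and "3 \<le> k + 1" and "k + 1 \<le> d"
    and "\<lfloor>(real d - 1) * (real k + 1) / 2\<rfloor> < int n"
    and "int n < \<lfloor>real d * (real k + 1) / 2\<rfloor>"
  shows "det_number (kneser_graph (n + 1) k) = d"
proof -
  let ?N = "n + 1" and ?G = "kneser_graph (n + 1) k"
  have k2: "2 \<le> k" using assms(3) by simp
  have lo: "(d - 1) * (k + 1) < 2 * n"
  proof -
    have "(real d - 1) * (real k + 1) / 2 < real n" using assms(5) by (simp add: floor_less_iff)
    moreover have "real (d - 1) = real d - 1" "real (k + 1) = real k + 1" using assms(2) by auto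
    then have "real ((d - 1) * (k + 1)) = (real d - 1) * (real k + 1)" by (simp only: of_nat_mult)
    ultimately have "real ((d - 1) * (k + 1)) < real (2 * n)" by simp
    then show ?thesis by (simp only: of_nat_less_iff)
  qed
  have hi: "2 * ?N \<le> d * (k + 1)"
  proof -
    have "real n + 1 \<le> real d * (real k + 1) / 2" using assms(6) by (simp add: less_floor_iff)
    then have "real (2 * ?N) \<le> real (d * (k + 1))" by (simp add: algebra_simps)
    then show ?thesis by (simp only: of_nat_le_iff)
  qed
  \<comment> \<open>From \<open>k (k + 1) \<le> (d - 1) (k + 1) < 2 n\<close> and the fact that no integer lies strictly between
    \<open>2\<close> and \<open>3\<close>: the claim reduces to \<open>(k - 2) (k - 3) \<ge> 0\<close>.\<close>
  have large: "3 * k \<le> ?N + 1"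
  proof -
    have "int k * (int k + 1) \<le> int (d - 1) * (int k + 1)"
      using assms(4) by (intro mult_right_mono) auto
    moreover have "int (d - 1) * (int k + 1) < 2 * int n"
    proof -
      have "int ((d - 1) * (k + 1)) < int (2 * n)" using lo by (simp only: of_nat_less_iff)
      moreover have "int ((d - 1) * (k + 1)) = int (d - 1) * (int k + 1)" unfolding of_nat_mult by simp
      ultimately show ?thesis by simp
    qed
    moreover have "0 \<le> (int k - 2) * (int k - 3)"
      using k2 by (cases "k = 2") (auto intro: mult_nonneg_nonneg)
    ultimately have "6 * int k \<le> 2 * int n + 5" by (simp add: algebra_simps)
    then show ?thesis by linarith
  qed
  have "(d - 1) * 3 < 2 * n"
    using lo k2 by (meson assms(3) le_less_trans mult_le_mono2)
  then have points: "d + 1 \<le> ?N" using assms(4) k2 by simp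
  have pairs: "?N \<le> d + 1 + (d choose 2)"
  proof -
    have "2 * ?N \<le> d * d" using hi assms(4) by (meson le_trans mult_le_mono2)
    moreover have "2 * (d choose 2) = d * (d - 1)"
      using times_binomial_minus1_eq[of 2 d] by simp
    moreover have "d * d = d * (d - 1) + d" using assms(2) by (cases d) auto
    ultimately have "2 * ?N \<le> 2 * (d choose 2) + d" by simp
    also have "\<dots> \<le> 2 * (d + 1 + (d choose 2))" by simp
    finally show ?thesis by simp
  qed
  have lower: "d \<le> card S" if S: "determining_set ?G S" for S
  proof (rule ccontr)
    assume "\<not> d \<le> card S"
    then have "card S * (k + 1) \<le> (d - 1) * (k + 1)" by (intro mult_le_mono1) simp
    moreover have "separates S {1..?N}"
      using determining_imp_separating[OF assms(1) _ S] large k2 by linarith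
    moreover have "S \<subseteq> ksets {1..?N} k"
      using S by (simp add: determining_set_def verts_kneser)
    ultimately show False using separating_family_bound[of "{1..?N}" S k] lo by simp
  qed
  obtain S where S: "S \<subseteq> ksets {1..?N} k" "separates S {1..?N}" "card S \<le> d"
    using separating_family_exists[of "{1..?N}" k d] points pairs hi large k2 by auto
  then have det: "determining_set ?G S"
    using separating_imp_determining[OF k2 large] by blast
  then have "card S = d" using lower S(3) by (simp add: le_antisym)
  then show ?thesis
    unfolding det_number_def using det lower by (intro Least_equality) auto
qed

end
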